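(* For any integer $n \ge 3$, let $P_n$ denote the path on $n$ vertices. Then the game cordiality number of $P_n$ satisfies \[ c_g(P_n) \le \begin{cases} \frac{n-3}{3} & \text{if } n \equiv 0 \pmod 3,\\ \frac{n-1}{3} & \text{if } n \equiv 1 \pmod 3,\\ \frac{n+1}{3} & \text{if } n \equiv 2 \pmod 3. \end{cases} \]
   Context: The cordiality game is played on a finite graph $G=(V,E)$ by two players, Admirable and Impish, who alternately select a previously unlabeled vertex of $G$ until all vertices are labeled; Admirable makes the first move. Admirable labels each vertex he selects by $0$ and Impish labels each vertex he selects by $1$. When all vertices are labeled, each edge receives as label the sum modulo $2$ of the labels of its two endpoints. Let $e_0$ and $e_1$ be the numbers of edges labeled $0$ and $1$ respectively, and let the discrepancy be $d = |e_1 - e_0|$. Admirable attempts to minimize $d$ and Impish attempts to maximize $d$. The game cordiality number $c_g(G)$ is the value of $d$ when both players play optimally (i.e. the minimax value of this finite perfect-information game). *)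

theory Defs
  imports Complex_Main
begin

text \<open>A graph is a pair of a vertex set and a set of edges, each edge being the
  two-element set of its endpoints.\<close>

type_synonym 'a ugraph = "'a set \<times> 'a set set"

definition finite_simple_graph :: "'a ugraph \<Rightarrow> bool" where
  "finite_simple_graph G \<longleftrightarrow>
     finite (fst G) \<and> (\<forall>e\<in>snd G. e \<subseteq> fst G \<and> card e = 2)"

definition path_graph :: "nat \<Rightarrow> nat ugraph" where
  "path_graph n = ({1..n}, {{i, i + 1} | i. 1 \<le> i \<and> i < n})"

lemma finite_simple_graph_path_graph: "finite_simple_graph (path_graph n)"
  unfolding finite_simple_graph_def path_graph_def by auto

datatype player = Admirable | Impish

text \<open>A position of the game is a partial labeling of the vertices.\<close>

type_synonym 'a labeling = "'a \<rightharpoonup> nat"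

definition edge_label :: "'a labeling \<Rightarrow> 'a set \<Rightarrow> nat" where
  "edge_label l e = (\<Sum>v\<in>e. the (l v)) mod 2"

definition discrepancy :: "'a ugraph \<Rightarrow> 'a labeling \<Rightarrow> int" where
  "discrepancy G l =
     \<bar>int (card {e \<in> snd G. edge_label l e = 1}) - int (card {e \<in> snd G. edge_label l e = 0})\<bar>"

definition unlabeled :: "'a ugraph \<Rightarrow> 'a labeling \<Rightarrow> 'a set" where
  "unlabeled G l = fst G - dom l"

text \<open>The minimax value of the position \<open>l\<close> with the given player to move. The
  finiteness test in the guard only serves to make the recursion total.\<close>

function game_value :: "'a ugraph \<Rightarrow> player \<Rightarrow> 'a labeling \<Rightarrow> int" where
  "game_value G Admirable l =
     (if finite (unlabeled G l) \<and> unlabeled G l \<noteq> {}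
      then Min ((\<lambda>v. game_value G Impish (l(v \<mapsto> 0))) ` unlabeled G l)
      else discrepancy G l)"
| "game_value G Impish l =
     (if finite (unlabeled G l) \<and> unlabeled G l \<noteq> {}
      then Max ((\<lambda>v. game_value G Admirable (l(v \<mapsto> 1))) ` unlabeled G l)
      else discrepancy G l)"
  by pat_completeness auto

lemma card_unlabeled_upd_less:
  assumes "finite (unlabeled G l)" "v \<in> unlabeled G l"
  shows "card (unlabeled G (l(v \<mapsto> a))) < card (unlabeled G l)"
  using assms by (intro psubset_card_mono) (auto simp: unlabeled_def)

termination
  by (relation "measure (\<lambda>(G, p, l). card (unlabeled G l))")
     (auto intro: card_unlabeled_upd_less simp del: fun_upd_apply)

declare game_value.simps [simp del]

definition game_cordiality_number :: "'a ugraph \<Rightarrow> int" where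
  "game_cordiality_number G = game_value G Admirable Map.empty"

end

theory Submission
  imports Defs
begin

text \<open>Pair up some of the vertices. Admirable can force the two vertices of every pair to receive
  different labels: he answers a move of Impish in an untouched pair by completing that pair, and
  when no answer is due he plays an unpaired vertex or, failing that, opens a pair. He opens a new
  pair only after the previous one has been completed by Impish, whose label is 1. On the path, cut
  off consecutive blocks of three vertices and pair the two ends of each block. If these ends differ,
  exactly one of the two edges inside the block is labeled 1, so only the \<open>n - 1 - 2\<lfloor>n/3\<rfloor>\<close>
  remaining edges contribute to the discrepancy.\<close>

section \<open>Pairing strategies\<close>

text \<open>The pairing is an involution \<open>f\<close> of \<open>V\<close> whose fixed points are
  the unpaired vertices. The set \<open>S\<close> exempts a pair that is half labeled at the
  moment.\<close>

definition pairs_split_except :: "'a set \<Rightarrow> ('a \<Rightarrow> 'a) \<Rightarrow> 'a set \<Rightarrow> 'a labeling \<Rightarrow> bool" where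
  "pairs_split_except V f S l \<longleftrightarrow>
     (\<forall>v\<in>V - S. f v \<noteq> v \<longrightarrow>
        l v = None \<and> l (f v) = None \<or>
        l v = Some 0 \<and> l (f v) = Some 1 \<or>
        l v = Some 1 \<and> l (f v) = Some 0)"

lemma pairs_split_except_mono:
  "pairs_split_except V f S l \<Longrightarrow> S \<subseteq> T \<Longrightarrow> pairs_split_except V f T l"
  unfolding pairs_split_except_def by blast

lemma pairs_split_except_upd:
  assumes f: "\<forall>v\<in>V. f v \<in> V \<and> f (f v) = v"
    and split: "pairs_split_except V f S l" and v: "f v = v \<or> {v, f v} \<subseteq> S"
  shows "pairs_split_except V f S (l(v \<mapsto> a))"
proof -
  have "w \<noteq> v \<and> f w \<noteq> v" if "w \<in> V - S" "f w \<noteq> w" for w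
    using bspec[OF f, of w] v that by auto
  with split show ?thesis unfolding pairs_split_except_def by simp
qed

text \<open>Impish to move: \<open>h\<close> is the vertex of the only pair, if any, that Admirable has opened.\<close>

definition impish_invariant :: "'a set \<Rightarrow> ('a \<Rightarrow> 'a) \<Rightarrow> 'a labeling \<Rightarrow> bool" where
  "impish_invariant V f l \<longleftrightarrow>
     pairs_split_except V f {} l \<or>
     (\<exists>h\<in>V. f h \<noteq> h \<and> l h = Some 0 \<and> l (f h) = None \<and>
        pairs_split_except V f {h, f h} l \<and> (\<forall>v\<in>V. f v = v \<longrightarrow> l v \<noteq> None))"

lemma impish_invariant_open_pair:
  assumes f: "\<forall>v\<in>V. f v \<in> V \<and> f (f v) = v"
    and "pairs_split_except V f {} l" "v \<in> V" "l v = None" "f v \<noteq> v"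
    and "\<forall>w\<in>V. f w = w \<longrightarrow> l w \<noteq> None"
  shows "impish_invariant V f (l(v \<mapsto> 0))"
proof -
  have "l (f v) = None" using assms unfolding pairs_split_except_def by force
  moreover have "pairs_split_except V f {v, f v} (l(v \<mapsto> 0))"
    using pairs_split_except_mono[OF assms(2)] by (intro pairs_split_except_upd[OF f]) auto
  ultimately show ?thesis using assms unfolding impish_invariant_def by auto
qed

text \<open>Unpaired vertices are spent first, so once Admirable must open a pair none of them is
  left, as the last clause of \<open>impish_invariant\<close> demands.\<close>

lemma admirable_move_preserves_invariant:
  assumes f: "\<forall>v\<in>V. f v \<in> V \<and> f (f v) = v"
    and split: "pairs_split_except V f {} l" and "V - dom l \<noteq> {}"
  shows "\<exists>v\<in>V - dom l. impish_invariant V f (l(v \<mapsto> 0))"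
proof (cases "\<exists>v\<in>V. f v = v \<and> l v = None")
  case True
  then obtain v where v: "v \<in> V" "f v = v" "l v = None" by blast
  have "pairs_split_except V f {} (l(v \<mapsto> 0))"
    using pairs_split_except_upd[OF f split] v by blast
  then show ?thesis using v unfolding impish_invariant_def by blast
next
  case False
  from assms(3) obtain v where v: "v \<in> V" "l v = None" by auto
  show ?thesis using impish_invariant_open_pair[OF f split v] False v by (metis DiffI domIff)
qed

text \<open>As \<open>f\<close> is an involution, every other pair is disjoint from
  \<open>{v, f v}\<close>. Keeping \<open>S\<close> general covers answers given while another pair
  is open.\<close>

lemma pairs_split_answer:
  assumes f: "\<forall>v\<in>V. f v \<in> V \<and> f (f v) = v"
    and "pairs_split_except V f S l" "v \<in> V" "f v \<noteq> v"
  shows "pairs_split_except V f S (l(v \<mapsto> 1, f v \<mapsto> 0))"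
  unfolding pairs_split_except_def
proof (intro ballI impI)
  fix w assume w: "w \<in> V - S" "f w \<noteq> w"
  consider "w = v" | "w = f v" | "w \<noteq> v" "w \<noteq> f v" "f w \<noteq> v" "f w \<noteq> f v"
    using f w assms(3) by (metis DiffD1)
  then show "(l(v \<mapsto> 1, f v \<mapsto> 0)) w = None \<and> (l(v \<mapsto> 1, f v \<mapsto> 0)) (f w) = None \<or>
        (l(v \<mapsto> 1, f v \<mapsto> 0)) w = Some 0 \<and> (l(v \<mapsto> 1, f v \<mapsto> 0)) (f w) = Some 1 \<or>
        (l(v \<mapsto> 1, f v \<mapsto> 0)) w = Some 1 \<and> (l(v \<mapsto> 1, f v \<mapsto> 0)) (f w) = Some 0"
  proof cases
    case 3
    then show ?thesis using assms(2) w unfolding pairs_split_except_def by auto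
  qed (use f assms(3,4) in auto)
qed

text \<open>If Impish takes an unpaired vertex or closes the open pair, no pair stays half labeled
  and Admirable moves freely. Otherwise Impish has entered an untouched pair, and the answer
  \<open>f v\<close> completes it.\<close>

lemma impish_move_cases:
  assumes f: "\<forall>v\<in>V. f v \<in> V \<and> f (f v) = v"
    and inv: "impish_invariant V f l" and v: "v \<in> V" "l v = None"
  obtains "pairs_split_except V f {} (l(v \<mapsto> 1))"
  | "f v \<in> V" "f v \<noteq> v" "l (f v) = None" "impish_invariant V f (l(v \<mapsto> 1, f v \<mapsto> 0))"
proof (cases "pairs_split_except V f {} l")
  case split: True
  show ?thesis
  proof (cases "f v = v")
    case True
    then have "pairs_split_except V f {} (l(v \<mapsto> 1))"
      using pairs_split_except_upd[OF f split] by blast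
    then show ?thesis by (rule that(1))
  next
    case False
    then have "l (f v) = None" using split v unfolding pairs_split_except_def by force
    with False show ?thesis
      using pairs_split_answer[OF f split v(1) False] f v that(2)
      unfolding impish_invariant_def by blast
  qed
next
  case False
  with inv obtain h where h: "h \<in> V" "f h \<noteq> h" "l h = Some 0" "l (f h) = None"
    and split: "pairs_split_except V f {h, f h} l"
    and free: "\<forall>v\<in>V. f v = v \<longrightarrow> l v \<noteq> None"
    unfolding impish_invariant_def by blast
  \<comment> \<open>With a pair open, Impish has no unpaired vertex to pass with, so Admirable is
    never forced to put a second 0 on his own pair.\<close>
  have fv: "f v \<noteq> v" using free v by blast
  show ?thesis
  proof (cases "v = f h")
    case True
    have "pairs_split_except V f {} (l(v \<mapsto> 1))"
      unfolding pairs_split_except_def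
    proof (intro ballI impI)
      fix w assume w: "w \<in> V - {}" "f w \<noteq> w"
      consider "w = h" | "w = f h" | "w \<noteq> h" "w \<noteq> f h" "f w \<noteq> h" "f w \<noteq> f h"
        using f w h(1) by (metis DiffD1)
      then show "(l(v \<mapsto> 1)) w = None \<and> (l(v \<mapsto> 1)) (f w) = None \<or>
        (l(v \<mapsto> 1)) w = Some 0 \<and> (l(v \<mapsto> 1)) (f w) = Some 1 \<or>
        (l(v \<mapsto> 1)) w = Some 1 \<and> (l(v \<mapsto> 1)) (f w) = Some 0"
      proof cases
        case 3
        then show ?thesis using True split w unfolding pairs_split_except_def by auto
      qed (use True f h in auto)
    qed
    then show ?thesis by (rule that(1))
  next
    case False
    have ne: "v \<noteq> h" using h v by auto
    then have *: "f v \<noteq> h" "f v \<noteq> f h" using f h v False by metis+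
    have "l (f v) = None"
      using split v fv ne False unfolding pairs_split_except_def by force
    \<comment> \<open>Both new labels avoid \<open>h\<close> and \<open>f h\<close>, so the same
      pair stays open and \<open>h\<close> is again the witness.\<close>
    moreover have "impish_invariant V f (l(v \<mapsto> 1, f v \<mapsto> 0))"
      using pairs_split_answer[OF f split v(1) fv] h free ne False *
      unfolding impish_invariant_def by (intro disjI2 bexI[of _ h]) auto
    ultimately show ?thesis using that(2) fv f v by blast
  qed
qed

text \<open>An open pair would have the unlabeled vertex \<open>f h\<close> in
  \<open>V\<close>.\<close>

lemma pairs_split_if_labeled:
  assumes f: "\<forall>v\<in>V. f v \<in> V \<and> f (f v) = v"
    and "impish_invariant V f l" "V \<subseteq> dom l"
  shows "pairs_split_except V f {} l"
  using f assms(2,3) unfolding impish_invariant_def by (auto simp: subset_iff domIff)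

text \<open>The claims for the two players are proved together by strong induction on the number of
  unlabeled vertices: the minimum is bounded by one good move, the maximum by treating every move of
  Impish.\<close>

lemma game_value_pairing_le:
  fixes G :: "'a ugraph"
  defines "V \<equiv> fst G"
  assumes fin: "finite V"
    and f: "\<forall>v\<in>V. f v \<in> V \<and> f (f v) = v"
    and bound: "\<And>l. V \<subseteq> dom l \<Longrightarrow> pairs_split_except V f {} l \<Longrightarrow> discrepancy G l \<le> B"
  shows "(pairs_split_except V f {} l \<longrightarrow> game_value G Admirable l \<le> B) \<and>
         (impish_invariant V f l \<longrightarrow> game_value G Impish l \<le> B)"
proof (induction "card (unlabeled G l)" arbitrary: l rule: less_induct)
  case less
  have finU: "finite (unlabeled G l')" for l'
    using fin unfolding unlabeled_def V_def by blast
  have U: "unlabeled G l' = V - dom l'" for l'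
    unfolding unlabeled_def V_def by simp
  have admirable_le: "game_value G Admirable l' \<le> B"
    if v: "v \<in> unlabeled G l'" and "game_value G Impish (l'(v \<mapsto> 0)) \<le> B" for l' v
  proof -
    have "game_value G Admirable l' =
        Min ((\<lambda>v. game_value G Impish (l'(v \<mapsto> 0))) ` unlabeled G l')"
      using finU v by (subst game_value.simps) auto
    also have "\<dots> \<le> game_value G Impish (l'(v \<mapsto> 0))"
      using finU v by (intro Min_le) auto
    finally show ?thesis using that(2) by linarith
  qed
  show ?case
  proof (intro conjI impI)
    assume split: "pairs_split_except V f {} l"
    show "game_value G Admirable l \<le> B"
    proof (cases "unlabeled G l = {}")
      case True
      then have "V \<subseteq> dom l" using U by auto
      then show ?thesis using True split bound by (subst game_value.simps) auto
    next
      case False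
      then obtain v where v: "v \<in> unlabeled G l" "impish_invariant V f (l(v \<mapsto> 0))"
        using admirable_move_preserves_invariant[OF f split] unfolding U by blast
      show ?thesis
        using admirable_le[OF v(1)] less[OF card_unlabeled_upd_less[OF finU v(1)]] v(2) by blast
    qed
  next
    assume inv: "impish_invariant V f l"
    show "game_value G Impish l \<le> B"
    proof (cases "unlabeled G l = {}")
      case True
      then have "V \<subseteq> dom l" using U by auto
      then show ?thesis
        using True pairs_split_if_labeled[OF f inv] bound by (subst game_value.simps) auto
    next
      case False
      have "game_value G Admirable (l(v \<mapsto> 1)) \<le> B" if v: "v \<in> unlabeled G l" for v
      proof -
        note smaller = card_unlabeled_upd_less[OF finU v, of 1]
        have "v \<in> V" "l v = None" using v unfolding U by auto
        then consider
            "pairs_split_except V f {} (l(v \<mapsto> 1))"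
          | "f v \<in> V" "f v \<noteq> v" "l (f v) = None"
            "impish_invariant V f (l(v \<mapsto> 1, f v \<mapsto> 0))"
          by (rule impish_move_cases[OF f inv])
        then show ?thesis
        proof cases
          case 1
          then show ?thesis using less[OF smaller] by blast
        next
          case 2
          \<comment> \<open>The position after the answer lies two moves ahead, with Impish to move
            again; this is where strong induction is used.\<close>
          then have fv: "f v \<in> unlabeled G (l(v \<mapsto> 1))" unfolding U by auto
          show ?thesis
            using admirable_le[OF fv]
              less[OF less_trans[OF card_unlabeled_upd_less[OF finU fv] smaller]] 2(4) by blast
        qed
      qed
      then show ?thesis using False finU by (subst game_value.simps) auto
    qed
  qed
qed

corollary game_cordiality_number_pairing_le:
  assumes "finite (fst G)"
    and "\<forall>v\<in>fst G. f v \<in> fst G \<and> f (f v) = v"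
    and "\<And>l. fst G \<subseteq> dom l \<Longrightarrow> pairs_split_except (fst G) f {} l \<Longrightarrow> discrepancy G l \<le> B"
  shows "game_cordiality_number G \<le> B"
proof -
  have "pairs_split_except (fst G) f {} Map.empty"
    unfolding pairs_split_except_def by simp
  with game_value_pairing_le[OF assms] show ?thesis
    unfolding game_cordiality_number_def by blast
qed

section \<open>Paths\<close>

text \<open>Block \<open>j\<close> consists of \<open>3 * j + 1\<close>, \<open>3 * j + 2\<close>,
  \<open>3 * j + 3\<close>. The guard \<open>v + 2 \<le> n\<close> leaves the at most two vertices
  after the last full block unpaired.\<close>

definition block_ends_swap :: "nat \<Rightarrow> nat \<Rightarrow> nat" where
  "block_ends_swap n v =
     (if v mod 3 = 1 \<and> v + 2 \<le> n then v + 2 else if v mod 3 = 0 then v - 2 else v)"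

lemma block_ends_swap_involution:
  assumes "v \<in> {1..n}"
  shows "block_ends_swap n v \<in> {1..n} \<and> block_ends_swap n (block_ends_swap n v) = v"
proof -
  define q where "q = v div 3"
  consider "v = 3 * q + 1" | "v = 3 * q + 2" | "v = 3 * q" unfolding q_def by linarith
  then show ?thesis
  proof cases
    case 1
    then have "v mod 3 = 1" "(v + 2) mod 3 = 0" by auto
    with assms show ?thesis unfolding block_ends_swap_def by simp
  next
    case 2
    then have "v mod 3 = 2" by presburger
    with assms show ?thesis unfolding block_ends_swap_def by simp
  next
    case 3
    \<comment> \<open>Since \<open>v\<close> is positive, \<open>q\<close> is too; this form makes
      the subtraction \<open>v - 2\<close> exact.\<close>
    with assms obtain p where p: "v = 3 * p + 3" by (cases q) auto
    then have "v mod 3 = 0" "v - 2 = 3 * p + 1" by simp_all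
    with p assms show ?thesis unfolding block_ends_swap_def by simp
  qed
qed

text \<open>The contribution of the edge \<open>{i, i + 1}\<close> to e_1 - e_0.\<close>

definition edge_sign :: "nat labeling \<Rightarrow> nat \<Rightarrow> int" where
  "edge_sign l i = (if edge_label l {i, i + 1} = 1 then 1 else - 1)"

lemma discrepancy_path_graph:
  "discrepancy (path_graph n) l = \<bar>\<Sum>i\<in>{1..<n}. edge_sign l i\<bar>"
proof -
  have inj: "inj_on (\<lambda>i::nat. {i, i + 1}) A" for A
    by (auto simp: inj_on_def doubleton_eq_iff)
  have card: "card {e \<in> snd (path_graph n). edge_label l e = c}
      = card {i \<in> {1..<n}. edge_label l {i, i + 1} = c}" for c
  proof -
    have "{e \<in> snd (path_graph n). edge_label l e = c}
        = (\<lambda>i. {i, i + 1}) ` {i \<in> {1..<n}. edge_label l {i, i + 1} = c}"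
      unfolding path_graph_def by auto
    then show ?thesis by (simp only: card_image[OF inj])
  qed
  \<comment> \<open>Labels are residues modulo 2, so the edges labeled 0 are exactly those with sign
    -1.\<close>
  have zero: "edge_label l e = 0 \<longleftrightarrow> edge_label l e \<noteq> 1" for e
    unfolding edge_label_def by auto
  have "(\<Sum>i\<in>{1..<n}. edge_sign l i)
      = int (card {i \<in> {1..<n}. edge_label l {i, i + 1} = 1})
        - int (card {i \<in> {1..<n}. edge_label l {i, i + 1} = 0})"
    unfolding edge_sign_def zero by (simp add: sum.If_cases Int_def)
  then show ?thesis unfolding discrepancy_def card by simp
qed

text \<open>With vertex labels a, b, c in the block, the edge labels are a + b and b + c modulo 2.
  Their sum is a + c modulo 2, which is 1, so exactly one of them is 1 whatever b is.\<close>

lemma edge_sign_block_cancel: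
  assumes split: "pairs_split_except {1..n} (block_ends_swap n) {} l"
    and n: "3 * j + 3 \<le> n" and dom: "{1..n} \<subseteq> dom l"
  shows "edge_sign l (3 * j + 1) + edge_sign l (3 * j + 2) = 0"
proof -
  have swap: "block_ends_swap n (3 * j + 1) = 3 * j + 3"
    using n unfolding block_ends_swap_def by simp
  have v: "3 * j + 1 \<in> {1..n} - {}" and ne: "block_ends_swap n (3 * j + 1) \<noteq> 3 * j + 1"
    using n swap by simp_all
  from v have "l (3 * j + 1) \<noteq> None" using dom by blast
  moreover
  note split[unfolded pairs_split_except_def, rule_format, OF v ne, unfolded swap]
  ultimately have ends: "the (l (3 * j + 1)) = 0 \<and> the (l (3 * j + 3)) = 1 \<or>
      the (l (3 * j + 1)) = 1 \<and> the (l (3 * j + 3)) = 0"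
    by (metis option.sel)
  have "edge_sign l i = (if (the (l i) + the (l (i + 1))) mod 2 = 1 then 1 else - 1)" for i
    unfolding edge_sign_def edge_label_def by simp
  \<comment> \<open>The indices are normalized so that the middle vertex is the same term in both
    signs.\<close>
  from this[of "3 * j + 1"] this[of "3 * j + 2"]
  have "edge_sign l (3 * j + 1)
      = (if (the (l (3 * j + 1)) + the (l (3 * j + 2))) mod 2 = 1 then 1 else - 1)"
    and "edge_sign l (3 * j + 2)
      = (if (the (l (3 * j + 2)) + the (l (3 * j + 3))) mod 2 = 1 then 1 else - 1)"
    by (simp_all only: add.assoc one_add_one numeral_plus_one add_num_simps)
  with ends show ?thesis
    by (elim disjE conjE; simp only: add_0 add_0_right; presburger)
qed

text \<open>The indices up to \<open>3 * k + 2\<close> are the inner edges of \<open>k + 1\<close>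
  blocks, which cancel, and the \<open>k\<close> edges \<open>3 * j + 3\<close> linking consecutive
  blocks.\<close>

lemma abs_sum_blocks_le:
  fixes s :: "nat \<Rightarrow> int"
  assumes "\<And>j. j \<le> k \<Longrightarrow> s (3 * j + 1) + s (3 * j + 2) = 0" and "\<And>i. \<bar>s i\<bar> \<le> 1"
  shows "\<bar>\<Sum>i\<in>{1..<3 * k + 3}. s i\<bar> \<le> int k"
  using assms(1)
proof (induction k)
  case 0
  from 0[of 0] show ?case by (simp add: numeral_eq_Suc)
next
  case (Suc k)
  \<comment> \<open>The new indices are one linking edge and the two inner edges of the new
    block.\<close>
  have "{1..<3 * Suc k + 3} = {1..<3 * k + 3} \<union> {3 * k + 3, 3 * k + 4, 3 * k + 5}"
    by auto
  then have "(\<Sum>i\<in>{1..<3 * Suc k + 3}. s i)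
      = (\<Sum>i\<in>{1..<3 * k + 3}. s i) + (s (3 * k + 3) + (s (3 * k + 4) + s (3 * k + 5)))"
    by (simp add: sum.union_disjoint)
  moreover have "s (3 * k + 4) + s (3 * k + 5) = 0"
    using Suc.prems[of "Suc k"] by (simp add: algebra_simps)
  moreover have "\<bar>\<Sum>i\<in>{1..<3 * k + 3}. s i\<bar> \<le> int k" using Suc by simp
  ultimately show ?case using assms(2)[of "3 * k + 3"] by simp
qed

lemma game_cordiality_number_path_graph_le:
  assumes "n \<ge> 3"
  shows "game_cordiality_number (path_graph n) \<le> int n - 1 - 2 * int (n div 3)"
proof (rule game_cordiality_number_pairing_le[where f = "block_ends_swap n"])
  show "finite (fst (path_graph n))" unfolding path_graph_def by simp
  show "\<forall>v\<in>fst (path_graph n).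
      block_ends_swap n v \<in> fst (path_graph n) \<and> block_ends_swap n (block_ends_swap n v) = v"
    using block_ends_swap_involution unfolding path_graph_def by simp
  fix l :: "nat labeling"
  assume "fst (path_graph n) \<subseteq> dom l"
    and "pairs_split_except (fst (path_graph n)) (block_ends_swap n) {} l"
  then have dom: "{1..n} \<subseteq> dom l"
    and split: "pairs_split_except {1..n} (block_ends_swap n) {} l"
    unfolding path_graph_def by simp_all
  \<comment> \<open>There are \<open>k + 1\<close> full blocks, at least one as
    \<open>n \<ge> 3\<close>, hence \<open>k\<close> links between them. The \<open>n mod 3\<close>
    edges after the last block bring the bound to \<open>k + n mod 3\<close>.\<close>
  define k where "k = n div 3 - 1"
  have n: "n = 3 * k + 3 + n mod 3" "n div 3 = Suc k" using assms unfolding k_def by presburger+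
  have sign: "\<bar>edge_sign l i\<bar> \<le> 1" for i unfolding edge_sign_def by simp
  have "\<bar>\<Sum>i\<in>{1..<3 * k + 3}. edge_sign l i\<bar> \<le> int k"
    using edge_sign_block_cancel[OF split _ dom] n sign by (intro abs_sum_blocks_le) auto
  moreover have "\<bar>\<Sum>i\<in>{3 * k + 3..<n}. edge_sign l i\<bar> \<le> int (n mod 3)"
  proof -
    have "\<bar>\<Sum>i\<in>{3 * k + 3..<n}. edge_sign l i\<bar> \<le> (\<Sum>i\<in>{3 * k + 3..<n}. 1)"
      using sign by (intro order_trans[OF sum_abs] sum_mono) auto
    also have "\<dots> = int (n mod 3)" using n(1) by simp
    finally show ?thesis .
  qed
  moreover have "(\<Sum>i\<in>{1..<n}. edge_sign l i)
      = (\<Sum>i\<in>{1..<3 * k + 3}. edge_sign l i) + (\<Sum>i\<in>{3 * k + 3..<n}. edge_sign l i)"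
    using n(1) by (intro sum.atLeastLessThan_concat[symmetric]) auto
  ultimately show "discrepancy (path_graph n) l \<le> int n - 1 - 2 * int (n div 3)"
    using n unfolding discrepancy_path_graph by linarith
qed

theorem theorem2p2:
  fixes n :: nat
  assumes "n \<ge> 3"
  shows "real_of_int (game_cordiality_number (path_graph n)) \<le>
    (if n mod 3 = 0 then (real n - 3) / 3
     else if n mod 3 = 1 then (real n - 1) / 3
     else (real n + 1) / 3)"
proof -
  have "real_of_int (game_cordiality_number (path_graph n)) \<le> real n - 1 - 2 * real (n div 3)"
    using game_cordiality_number_path_graph_le[OF assms] by linarith
  \<comment> \<open>With r = \<open>n mod 3\<close> the bound becomes (n - 3 + 2r)/3, which gives
    the three cases.\<close>
  moreover have "real n = 3 * real (n div 3) + real (n mod 3)"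
    by (metis mult_div_mod_eq of_nat_add of_nat_mult of_nat_numeral)
  moreover have "n mod 3 = 0 \<or> n mod 3 = 1 \<or> n mod 3 = 2" by presburger
  ultimately show ?thesis by (auto simp: field_simps)
qed

end
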